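(* For every odd integer $q\ge3$, $$\lim_{r\to\infty}a_q(r)^{1/r}=B_q.$$ The function $q\mapsto B_q$ (on odd integers $q\ge3$) is strictly increasing. In particular, $$\lim_{r\to\infty}\left(\frac{a_5(r)}{a_3(r)}\right)^{1/r}=\frac{B_5}{B_3}\approx1.7218785536$$ and $$\lim_{r\to\infty}\left(\frac{a_7(r)}{a_5(r)}\right)^{1/r}=\frac{B_7}{B_5}\approx1.2726660717,$$ where $\approx$ denotes numerical approximation to the displayed decimals.
   Context: For an odd integer $q\ge3$, a $q$-admissible word of order $r\ge1$ is a finite word $w=(x_1,\dots,x_L)$ with each $x_j\in\{q/2,\,1/2\}$, containing exactly $r$ occurrences of $q/2$, such that $\prod_{j=1}^{\ell}x_j>1$ for all $1\le \ell<L$ and $\prod_{j=1}^{L}x_j<1$. Let $a_q(r)$ be the number of $q$-admissible words of order $r$. (The sequences $a_3,a_5,a_7$ are OEIS A100982, A174795, A174796.) Put $\alpha_q=\log_2 q$, $B(\alpha)=\dfrac{\alpha^{\alpha}}{(\alpha-1)^{\alpha-1}}$ for real $\alpha>1$, and $B_q=B(\alpha_q)$. *)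

theory Defs
  imports Complex_Main
begin

definition admissible :: "nat \<Rightarrow> nat \<Rightarrow> real list \<Rightarrow> bool" where
  "admissible q r w \<longleftrightarrow>
     r \<ge> 1 \<and>
     set w \<subseteq> {real q / 2, 1 / 2} \<and>
     count_list w (real q / 2) = r \<and>
     (\<forall>l. 1 \<le> l \<and> l < length w \<longrightarrow> prod_list (take l w) > 1) \<and>
     prod_list w < 1"

(* For odd q \<ge> 3 this set is finite: the order r and the two product conditions
   determine the length of w. So card does not fall back to its value 0 on infinite sets. *)
definition num_admissible :: "nat \<Rightarrow> nat \<Rightarrow> nat" where
  "num_admissible q r = card {w. admissible q r w}"

definition alpha :: "nat \<Rightarrow> real" where
  "alpha q = log 2 (real q)"

(* Meaningful for a > 1 only. *)
definition B :: "real \<Rightarrow> real" where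
  "B a = a powr a / (a - 1) powr (a - 1)"

definition B_odd :: "nat \<Rightarrow> real" where
  "B_odd q = B (alpha q)"

end

theory Submission
  imports Defs "HOL-Analysis.Harmonic_Numbers" "HOL-Real_Asymp.Real_Asymp"
begin

text \<open>
  An admissible word of order \<open>r\<close> ends in \<open>1 / 2\<close>, and deleting this letter leaves a word of length
  \<open>n = \<lfloor>\<alpha>\<^sub>q r\<rfloor>\<close> with \<open>r\<close> letters \<open>q / 2\<close> all of whose partial products exceed \<open>1\<close>. Each of
  the \<open>n choose r\<close> unrestricted words is a rotation of such a word, so
  \<open>a\<^sub>q(r)\<close> lies between \<open>(n choose r) / n\<close> and \<open>n choose r\<close>. Comparing \<open>n choose r\<close> with the largest
  term in the expansion of \<open>(r + (n - r))\<^sup>n\<close> shows that it equals \<open>B(n / r)\<^sup>r\<close> up to a factor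
  \<open>n + 1\<close>, and \<open>n / r\<close> tends to \<open>\<alpha>\<^sub>q\<close>.

  Monotonicity comes from \<open>(ln B)' = ln (a / (a - 1))\<close>. It also reduces the numerical claims to
  rational arguments: \<open>\<alpha>\<^sub>q\<close> is enclosed between fractions with small denominator, whose logarithms
  are computed by pulling out a product of powers of \<open>2, 3, 5, 7\<close>, so that the series of
  \<open>artanh\<close> converges fast on the remaining factor close to \<open>1\<close>.
\<close>

subsection \<open>Admissible words and the cycle lemma\<close>

lemma card_lists_count_list:
  fixes a b :: "'a"
  assumes "a \<noteq> b"
  shows "card {w. set w \<subseteq> {a, b} \<and> length w = n \<and> count_list w a = r} = n choose r"
proof -
  let ?W = "\<lambda>n r. {w. set w \<subseteq> {a, b} \<and> length w = n \<and> count_list w a = r}"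
  have finW: "finite (?W n r)" for n r
    by (rule finite_subset[OF _ finite_lists_length_eq[of "{a, b}" n]]) auto
  show "card (?W n r) = n choose r"
  proof (induction n arbitrary: r)
    case 0
    have "?W 0 r = (if r = 0 then {[]} else {})" by auto
    then show ?case by (cases r) auto
  next
    case (Suc n)
    have split0: "?W (Suc n) 0 = Cons b ` ?W n 0" (is "_ = ?R")
    proof (intro set_eqI)
      fix w show "w \<in> ?W (Suc n) 0 \<longleftrightarrow> w \<in> ?R"
        using assms by (cases w) (auto simp: image_iff)
    qed
    have split: "?W (Suc n) (Suc k) = Cons a ` ?W n k \<union> Cons b ` ?W n (Suc k)" (is "_ = ?R") for k
    proof (intro set_eqI)
      fix w show "w \<in> ?W (Suc n) (Suc k) \<longleftrightarrow> w \<in> ?R"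
        using assms by (cases w) (auto simp: image_iff)
    qed
    show ?case
    proof (cases r)
      case 0
      have "card (?W (Suc n) 0) = 1"
        unfolding split0 by (subst card_image) (use Suc.IH[of 0] in auto)
      then show ?thesis by (simp only: 0 binomial_n_0)
    next
      case (Suc k)
      have "card (?W (Suc n) (Suc k)) = card (Cons a ` ?W n k) + card (Cons b ` ?W n (Suc k))"
        unfolding split by (rule card_Un_disjoint) (use assms finW in auto)
      also have "\<dots> = (n choose k) + (n choose Suc k)"
        by (subst (1 2) card_image) (use Suc.IH in auto)
      finally show ?thesis by (simp only: Suc binomial_Suc_Suc)
    qed
  qed
qed

definition lattice_words :: "nat \<Rightarrow> nat \<Rightarrow> nat \<Rightarrow> real list set" where
  "lattice_words q n r =
     {w. set w \<subseteq> {real q / 2, 1 / 2} \<and> length w = n \<and> count_list w (real q / 2) = r}"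

text \<open>These are the admissible words stripped of their final letter, so the condition covers
  the whole word \<open>l = n\<close> as well.\<close>

definition positive_words :: "nat \<Rightarrow> nat \<Rightarrow> nat \<Rightarrow> real list set" where
  "positive_words q n r =
     {w \<in> lattice_words q n r. \<forall>l. 1 \<le> l \<and> l \<le> n \<longrightarrow> prod_list (take l w) > 1}"

lemma finite_lattice_words: "finite (lattice_words q n r)"
  unfolding lattice_words_def
  by (rule finite_subset[OF _ finite_lists_length_eq[of "{real q / 2, 1 / 2}" n]]) auto

lemma card_lattice_words: "q \<noteq> 1 \<Longrightarrow> card (lattice_words q n r) = n choose r"
  unfolding lattice_words_def using card_lists_count_list[of "real q / 2" "1 / 2" n r] by simp

lemma prod_list_letters:
  assumes "set w \<subseteq> {real q / 2, 1 / 2}" "q \<noteq> 1"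
  shows "prod_list w = real q ^ count_list w (real q / 2) / 2 ^ length w"
  using assms by (induction w) (auto simp: field_simps)

lemma prod_list_letters_pos:
  assumes "set w \<subseteq> {real q / 2, 1 / 2}" "q > 0"
  shows "prod_list w > 0"
  using assms by (induction w) auto

text \<open>Cutting a word at the last minimum of its partial products and rotating there
  makes all partial products exceed \<open>1\<close>.\<close>

lemma lattice_words_subset_rotations:
  assumes q: "q \<ge> 2" and n: "n \<ge> 1" and big: "2 ^ n < q ^ r"
  shows "lattice_words q n r \<subseteq> (\<Union>i\<in>{1..n}. rotate i ` positive_words q n r)"
proof
  fix v assume v: "v \<in> lattice_words q n r"
  define p where "p j = prod_list (take j v)" for j
  have len: "length v = n" and setv: "set v \<subseteq> {real q / 2, 1 / 2}"
    and cnt: "count_list v (real q / 2) = r"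
    using v by (auto simp: lattice_words_def)
  have p_pos: "p j > 0" for j
    unfolding p_def using q setv by (intro prod_list_letters_pos) (auto dest: in_set_takeD)
  have "real (2 ^ n) < real (q ^ r)" using big by (simp only: of_nat_less_iff)
  then have pn: "p n > 1"
    using prod_list_letters[OF setv] q by (simp add: p_def len cnt)
  \<comment> \<open>The positions \<open>0..n-1\<close> where \<open>p\<close> is minimal. The
    largest of them is needed: after the last minimum, \<open>p\<close> stays strictly above
    \<open>p m\<close>.\<close>
  let ?M = "{m. m < n \<and> (\<forall>j<n. p m \<le> p j)}"
  have finM: "finite ?M" by simp
  have "\<exists>m. is_arg_min p (\<lambda>j. j \<in> {..<n}) m"
    using n by (intro ex_is_arg_min_if_finite) (auto simp: lessThan_empty_iff)
  then have neM: "?M \<noteq> {}" by (auto simp: is_arg_min_linorder)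
  define m where "m = Max ?M"
  have "m \<in> ?M" unfolding m_def using Max_in[OF finM neM] .
  then have m: "m < n" and min: "\<And>j. j < n \<Longrightarrow> p m \<le> p j" by auto
  \<comment> \<open>The endpoint \<open>j = n\<close> lies outside the range of \<open>?M\<close>.
    It is handled by \<open>p m \<le> p 0 = 1 < p n\<close>.\<close>
  have strict: "p m < p j" if "m < j" "j \<le> n" for j
  proof (cases "j = n")
    case True
    have "p m \<le> p 0" using min n by simp
    then show ?thesis using pn True by (simp add: p_def)
  next
    case False
    show ?thesis
    proof (rule ccontr)
      assume "\<not> p m < p j"
      then have "j \<in> ?M" using min False that by force
      then have "j \<le> m" unfolding m_def using finM by (rule Max_ge[rotated])
      then show False using that by simp
    qed
  qed
  have rot: "rotate m v = drop m v @ take m v"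
    using m len by (simp add: rotate_drop_take)
  have split: "p (i + j) = p i * prod_list (take j (drop i v))" for i j
    unfolding p_def by (simp add: take_add)
  \<comment> \<open>A prefix that does not wrap around has product \<open>p (m + l) / p m\<close>.
    One that wraps around and takes \<open>k\<close> letters from the start of \<open>v\<close> has
    product \<open>p n * p k / p m\<close>, where \<open>p n > 1\<close> and
    \<open>p k \<ge> p m\<close>.\<close>
  have "prod_list (take l (rotate m v)) > 1" if l: "1 \<le> l" "l \<le> n" for l
  proof (cases "l \<le> n - m")
    case True
    have "p m < p m * prod_list (take l (drop m v))"
      using strict[of "m + l"] l m True by (simp flip: split)
    then show ?thesis using p_pos[of m] True len by (simp add: rot)
  next
    case False
    define k where "k = l - (n - m)"
    have k: "k \<le> m" "k < n" using False l m by (auto simp: k_def)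
    have "prod_list (take l (rotate m v)) = prod_list (drop m v) * p k"
      using False len k by (simp add: rot p_def k_def min_def)
    moreover have "p n = p m * prod_list (drop m v)"
      using split[of m "n - m"] m len by simp
    moreover have "p m < p n * p k"
      using min[OF k(2)] mult_strict_right_mono[OF pn p_pos[of k]] by simp
    ultimately have "p m * 1 < p m * prod_list (take l (rotate m v))" by (simp add: mult_ac)
    then show ?thesis using p_pos[of m] mult_less_cancel_left_pos by blast
  qed
  moreover have "count_list (rotate m v) (real q / 2) = r"
    using cnt count_list_append[of "take m v" "drop m v" "real q / 2"] by (simp add: rot)
  ultimately have "rotate m v \<in> positive_words q n r"
    using len setv by (simp add: positive_words_def lattice_words_def)
  \<comment> \<open>Rotating by \<open>m\<close> and then by \<open>n - m\<close> is a full turn.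
    Since \<open>m < n\<close>, only the \<open>n\<close> shifts \<open>1..n\<close> occur.\<close>
  moreover have "v = rotate (n - m) (rotate m v)"
    using m len by (simp add: rotate_rotate)
  moreover have "n - m \<in> {1..n}" using m by auto
  ultimately show "v \<in> (\<Union>i\<in>{1..n}. rotate i ` positive_words q n r)" by blast
qed

text \<open>The \<open>n\<close> rotated copies of the positive words cover all words but may
  overlap. Hence the union bound costs a factor of at most \<open>n\<close>.\<close>

lemma card_positive_words_bounds:
  assumes "q \<ge> 2" "n \<ge> 1" "2 ^ n < q ^ r"
  shows "n choose r \<le> n * card (positive_words q n r)"
    and "card (positive_words q n r) \<le> n choose r"
proof -
  have fin: "finite (positive_words q n r)"
    unfolding positive_words_def using finite_lattice_words by simp
  have "n choose r = card (lattice_words q n r)" using assms by (simp add: card_lattice_words)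
  also have "\<dots> \<le> card (\<Union>i\<in>{1..n}. rotate i ` positive_words q n r)"
    using lattice_words_subset_rotations[OF assms] fin by (intro card_mono) auto
  also have "\<dots> \<le> (\<Sum>i\<in>{1..n}. card (rotate i ` positive_words q n r))"
    by (rule card_UN_le) simp
  also have "\<dots> \<le> (\<Sum>i\<in>{1..n}. card (positive_words q n r))"
    by (intro sum_mono card_image_le fin)
  finally show "n choose r \<le> n * card (positive_words q n r)" by simp
  have "card (positive_words q n r) \<le> card (lattice_words q n r)"
    by (intro card_mono finite_lattice_words) (auto simp: positive_words_def)
  then show "card (positive_words q n r) \<le> n choose r" using assms by (simp add: card_lattice_words)
qed

text \<open>A word with \<open>r\<close> letters \<open>q / 2\<close> has product
  \<open>q ^ r / 2 ^ length w\<close>. The bracket for \<open>q ^ r\<close> therefore makes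
  \<open>Suc n\<close> the only length at which the product can be below 1 while the prefix one
  letter shorter is still above 1.\<close>

lemma admissible_iff_positive_words:
  assumes q: "q \<ge> 3" and r: "r \<ge> 1" and n: "2 ^ n < q ^ r" "q ^ r < 2 ^ Suc n"
  shows "{w. admissible q r w} = (\<lambda>v. v @ [1 / 2]) ` positive_words q n r"
proof (intro set_eqI iffI)
  have n': "(2::real) ^ n < real q ^ r" "real q ^ r < 2 ^ Suc n"
    using n[folded of_nat_less_iff[where 'a = real]] by simp_all
  {
    fix w assume "w \<in> {w. admissible q r w}"
    then have setw: "set w \<subseteq> {real q / 2, 1 / 2}" and cnt: "count_list w (real q / 2) = r"
      and pre: "\<And>l. 1 \<le> l \<Longrightarrow> l < length w \<Longrightarrow> prod_list (take l w) > 1"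
      and tot: "prod_list w < 1"
      by (auto simp: admissible_def)
    have "w \<noteq> []" using cnt r by auto
    then obtain v x where w: "w = v @ [x]" by (metis rev_exhaust)
    have pre_v: "prod_list (take l v) > 1" if "1 \<le> l" "l \<le> length v" for l
      using pre[of l] that by (simp add: w)
    \<comment> \<open>Not strict, because the prefix condition says nothing about an empty
      \<open>v\<close>, whose product is 1.\<close>
    have v1: "prod_list v \<ge> 1" using pre_v[of "length v"] by (cases v) auto
    have x: "x = 1 / 2"
    proof (rule ccontr)
      assume "x \<noteq> 1 / 2"
      then have "x = real q / 2" using setw w by auto
      then have "prod_list w \<ge> 1 * 1"
        using mult_mono[of 1 "prod_list v" 1 x] v1 q by (simp add: w)
      then show False using tot by simp
    qed
    have cntv: "count_list v (real q / 2) = r" using cnt q by (simp add: w x split: if_splits)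
    have "real q ^ r / 2 ^ length w < 1"
      using tot prod_list_letters[OF setw] q cnt by simp
    then have "real q ^ r < 2 ^ length w" by simp
    then have "(2::real) ^ n < 2 ^ length w" using n'(1) by (rule order.strict_trans[rotated])
    then have "n < length w" by simp
    \<comment> \<open>A longer \<open>v\<close> would have full product above 1, giving
      \<open>2 ^ length v < q ^ r < 2 ^ Suc n\<close>.\<close>
    moreover have "length v \<le> n"
    proof (rule ccontr)
      assume *: "\<not> length v \<le> n"
      then have "prod_list v > 1" using pre_v[of "length v"] by simp
      moreover have "prod_list v = real q ^ r / 2 ^ length v"
        using prod_list_letters[of v q] setw q cntv by (simp add: w)
      ultimately have "(2::real) ^ length v < real q ^ r" by simp
      then have "(2::real) ^ length v < 2 ^ Suc n" using n' by linarith
      then show False using * by (subst (asm) power_strict_increasing_iff) auto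
    qed
    ultimately have "length v = n" by (simp add: w)
    then have "v \<in> positive_words q n r"
      using setw cntv pre_v by (auto simp: w positive_words_def lattice_words_def)
    then show "w \<in> (\<lambda>v. v @ [1 / 2]) ` positive_words q n r" by (auto simp: w x)
  }
  {
    fix w assume "w \<in> (\<lambda>v. v @ [1 / 2]) ` positive_words q n r"
    then obtain v where w: "w = v @ [1 / 2]" and v: "v \<in> positive_words q n r" by blast
    have setw: "set w \<subseteq> {real q / 2, 1 / 2}" and cnt: "count_list w (real q / 2) = r"
      and len: "length w = Suc n"
      using v q by (auto simp: w positive_words_def lattice_words_def)
    have "prod_list w < 1"
      using q n'(2) by (simp add: prod_list_letters[OF setw] cnt len)
    then show "w \<in> {w. admissible q r w}"
      using setw cnt len v r by (auto simp: admissible_def positive_words_def w)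
  }
qed

lemma num_admissible_bounds:
  assumes "q \<ge> 3" "r \<ge> 1" "2 ^ n < q ^ r" "q ^ r < 2 ^ Suc n"
  shows "n choose r \<le> n * num_admissible q r" "num_admissible q r \<le> n choose r"
proof -
  have "num_admissible q r = card (positive_words q n r)"
    unfolding num_admissible_def admissible_iff_positive_words[OF assms]
    by (intro card_image) (auto intro: inj_onI)
  \<comment> \<open>For \<open>n = 0\<close> the upper bracket would read \<open>q ^ r < 2\<close>,
    although \<open>q ^ r \<ge> q \<ge> 3\<close>.\<close>
  moreover have "n \<ge> 1"
    using assms self_le_power[of q r] by (cases n) auto
  ultimately show "n choose r \<le> n * num_admissible q r" "num_admissible q r \<le> n choose r"
    using card_positive_words_bounds[of q n r] assms by auto
qed

subsection \<open>Entropy bounds for binomial coefficients\<close>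

lemma B_pos: "a > 1 \<Longrightarrow> B a > 0"
  by (simp add: B_def)

lemma ln_B: "a > 1 \<Longrightarrow> ln (B a) = a * ln a - (a - 1) * ln (a - 1)"
  by (simp add: B_def ln_div ln_powr)

lemma B_strict_mono:
  assumes "1 < a" "a < b"
  shows "B a < B b"
proof -
  let ?f = "\<lambda>x. x * ln x - (x - 1) * ln (x - 1 :: real)"
  have "\<exists>D. (?f has_real_derivative D) (at x) \<and> D > 0" if "a \<le> x" "x \<le> b" for x
  proof (intro exI conjI)
    \<comment> \<open>The product rule gives \<open>ln x + 1\<close> and
      \<open>ln (x - 1) + 1\<close>, and the ones cancel.\<close>
    show "(?f has_real_derivative ln x - ln (x - 1)) (at x)"
      using that assms by (auto intro!: derivative_eq_intros)
    show "ln x - ln (x - 1) > 0" using that assms by simp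
  qed
  then have "?f a < ?f b"
    by (rule DERIV_pos_imp_increasing[OF assms(2)])
  then have "ln (B a) < ln (B b)" using assms by (simp add: ln_B)
  then show ?thesis using assms by (simp add: B_pos)
qed

lemma isCont_B:
  assumes "a > 1"
  shows "isCont B a"
  unfolding B_def using assms by (intro continuous_intros) auto

text \<open>With \<open>a = n / k\<close> one has \<open>n = a * k\<close> and
  \<open>n - k = (a - 1) * k\<close>, so
  \<open>B a ^ k = n ^ n / (k ^ k * (n - k) ^ (n - k))\<close>. This is
  \<open>exp (n * H (k / n))\<close> for the binary entropy \<open>H\<close> in natural
  units.\<close>

lemma B_of_quotient_power:
  assumes "0 < k" "k < n"
  shows "B (real n / real k) ^ k * (real k ^ k * real (n - k) ^ (n - k)) = real n ^ n"
proof -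
  define a where "a = real n / real k"
  have a: "a > 1" and n: "real n = a * real k" and nk: "real (n - k) = (a - 1) * real k"
    using assms by (simp_all add: a_def of_nat_diff field_simps)
  have "B a ^ k = a powr (a * k) / (a - 1) powr ((a - 1) * k)"
    using a by (simp add: B_def power_divide powr_powr flip: powr_realpow)
  also have "\<dots> = a ^ n / (a - 1) ^ (n - k)"
    using a by (simp flip: n nk add: powr_realpow)
  finally have B: "B a ^ k * (a - 1) ^ (n - k) = a ^ n"
    using a by simp
  have "B a ^ k * (real k ^ k * real (n - k) ^ (n - k)) =
      (B a ^ k * (a - 1) ^ (n - k)) * (real k ^ k * real k ^ (n - k))"
    by (simp only: nk power_mult_distrib mult_ac)
  also have "\<dots> = a ^ n * real k ^ n"
    unfolding B using assms by (simp flip: power_add)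
  also have "\<dots> = real n ^ n" by (simp only: n power_mult_distrib)
  finally show ?thesis by (simp only: a_def)
qed

text \<open>The terms are unimodal with mode \<open>k\<close>: the quotient of term
  \<open>j + 1\<close> by term \<open>j\<close> is \<open>(n - j) * k / ((j + 1) * (n - k))\<close>,
  which is at least 1 for \<open>j < k\<close> and at most 1 for \<open>j \<ge> k\<close>. The
  quotient is used with denominators cleared, in natural numbers.\<close>

lemma binomial_term_le:
  assumes "k < n" "j \<le> n"
  shows "(n choose j) * k ^ j * (n - k) ^ (n - j) \<le> (n choose k) * k ^ k * (n - k) ^ (n - k)"
proof -
  define t where "t j = (n choose j) * k ^ j * (n - k) ^ (n - j)" for j
  have ratio: "t (Suc j) * (Suc j * (n - k)) = t j * ((n - j) * k)" if "j < n" for j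
  proof -
    \<comment> \<open>By the absorption identities both sides equal
      \<open>n * ((n - 1) choose j)\<close>.\<close>
    have "Suc j * (n choose Suc j) = (n - j) * (n choose j)"
      using binomial_absorb_comp[of n j] binomial_absorption[of j n] by simp
    moreover have "(n - k) ^ (n - j) = (n - k) * (n - k) ^ (n - Suc j)"
      using that by (metis Suc_diff_Suc power_Suc)
    ultimately have "(Suc j * (n choose Suc j)) * (k ^ Suc j * ((n - k) * (n - k) ^ (n - Suc j))) =
        ((n - j) * (n choose j)) * (k * k ^ j * (n - k) ^ (n - j))"
      by (simp only: power_Suc)
    then show ?thesis by (simp only: t_def mult_ac)
  qed
  have up: "t j \<le> t (Suc j)" if "j < k" for j
  proof -
    have "Suc j * (n - k) \<le> (n - j) * k"
      using that assms by (subst mult.commute) (intro mult_mono, auto)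
    then have "t j * (Suc j * (n - k)) \<le> t (Suc j) * (Suc j * (n - k))"
      using ratio[of j] that assms(1) by (metis mult_le_mono2 order.strict_trans)
    then show ?thesis using assms by (simp only: mult_le_cancel2) simp
  qed
  have down: "t (Suc j) \<le> t j" if "k \<le> j" "j < n" for j
  proof -
    have "(n - j) * k \<le> Suc j * (n - k)"
      using that assms by (subst mult.commute) (intro mult_mono, auto)
    then have "t (Suc j) * (Suc j * (n - k)) \<le> t j * (Suc j * (n - k))"
      unfolding ratio[OF that(2)] by (rule mult_le_mono2)
    then show ?thesis using assms by (simp only: mult_le_cancel2) simp
  qed
  have "t j \<le> t k"
  proof (cases "j \<le> k")
    case True
    then show ?thesis
    proof (induction rule: inc_induct)
      case (step i)
      then show ?case using up[of i] by linarith
    qed simp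
  next
    case False
    then have "k \<le> j" by simp
    then show ?thesis using assms(2)
    proof (induction rule: dec_induct)
      case (step i)
      then show ?case using down[of i] by linarith
    qed simp
  qed
  then show ?thesis by (simp add: t_def)
qed

text \<open>Expanding \<open>(k + (n - k)) ^ n = n ^ n\<close> gives \<open>n + 1\<close> terms.
  Keeping only term \<open>k\<close> yields the first bound, and replacing every term by this
  largest one yields the second.\<close>

lemma binomial_entropy_bounds:
  assumes "0 < k" "k < n"
  shows "real (n choose k) \<le> B (real n / real k) ^ k"
    and "B (real n / real k) ^ k \<le> real (Suc n) * real (n choose k)"
proof -
  define c where "c = k ^ k * (n - k) ^ (n - k)"
  have c: "real c > 0" using assms by (simp add: c_def)
  have expand: "(\<Sum>j\<le>n. (n choose j) * k ^ j * (n - k) ^ (n - j)) = n ^ n"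
    using binomial_ring[of k "n - k" n] assms by simp
  have B: "B (real n / real k) ^ k * real c = real n ^ n"
    using B_of_quotient_power[OF assms] by (simp add: c_def)
  have "(n choose k) * k ^ k * (n - k) ^ (n - k) \<le> n ^ n"
    unfolding expand[symmetric] using assms by (intro member_le_sum) auto
  then have "real ((n choose k) * c) \<le> real (n ^ n)"
    by (simp only: of_nat_le_iff c_def mult.assoc)
  then have "real (n choose k) * real c \<le> B (real n / real k) ^ k * real c"
    by (simp only: B of_nat_mult of_nat_power)
  then show "real (n choose k) \<le> B (real n / real k) ^ k"
    using c by (simp only: mult_le_cancel_right_pos)
  have "n ^ n \<le> (\<Sum>j\<le>n. (n choose k) * k ^ k * (n - k) ^ (n - k))"
    unfolding expand[symmetric] using assms by (intro sum_mono binomial_term_le) auto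
  then have "n ^ n \<le> Suc n * (n choose k) * c" by (simp add: c_def algebra_simps)
  then have "real (n ^ n) \<le> real (Suc n * (n choose k) * c)" by (simp only: of_nat_le_iff)
  then have "B (real n / real k) ^ k * real c \<le> real (Suc n) * real (n choose k) * real c"
    by (simp only: B of_nat_mult of_nat_power)
  then show "B (real n / real k) ^ k \<le> real (Suc n) * real (n choose k)"
    using c by (simp only: mult_le_cancel_right_pos)
qed

subsection \<open>Growth rate\<close>

lemma alpha_gt_1: "q \<ge> 3 \<Longrightarrow> alpha q > 1"
  by (simp add: alpha_def less_log_iff)

lemma powr_alpha: "q > 0 \<Longrightarrow> 2 powr (alpha q * real r) = real q ^ r"
  by (simp add: alpha_def powr_realpow flip: powr_powr)

lemma power_2_floor_alpha:
  assumes "odd q" "q \<ge> 3" "n = nat \<lfloor>alpha q * real r\<rfloor>" "n \<ge> 1"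
  shows "2 ^ n < q ^ r" "q ^ r < 2 ^ Suc n"
proof -
  have pos: "alpha q * real r \<ge> 0" using alpha_gt_1[of q] assms by simp
  have le: "real n \<le> alpha q * real r" and less: "alpha q * real r < real (Suc n)"
    unfolding assms(3) using pos by linarith+
  have "2 powr real n \<le> real q ^ r"
    using le assms by (simp flip: powr_alpha)
  then have "real (2 ^ n) \<le> real (q ^ r)" by (simp add: powr_realpow)
  then have "2 ^ n \<le> q ^ r" by (simp only: of_nat_le_iff)
  \<comment> \<open>The floor gives only a weak inequality. Parity makes it strict, and this is
    where \<open>q\<close> odd and \<open>n \<ge> 1\<close> enter.\<close>
  moreover have "even ((2::nat) ^ n)" "odd (q ^ r)" using assms(1,4) by simp_all
  then have "2 ^ n \<noteq> q ^ r" by metis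
  ultimately show "2 ^ n < q ^ r" by simp
  have "real q ^ r < 2 powr real (Suc n)"
    using less assms by (simp flip: powr_alpha del: of_nat_Suc)
  then have "real (q ^ r) < real (2 ^ Suc n)" by (simp add: powr_realpow del: of_nat_Suc power_Suc)
  then show "q ^ r < 2 ^ Suc n" by (simp only: of_nat_less_iff)
qed

text \<open>The rotations lose a factor \<open>n\<close> and the binomial expansion a factor
  \<open>n + 1\<close>. Only the \<open>r\<close>-th root of their product survives.\<close>

lemma num_admissible_powr_bounds:
  assumes q: "odd q" "q \<ge> 3" and n: "n = nat \<lfloor>alpha q * real r\<rfloor>" and r: "0 < r" "r < n"
  shows "real (num_admissible q r) powr (1 / real r) \<le> B (real n / real r)"
    and "B (real n / real r) / (real (Suc n) * real n) powr (1 / real r)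
           \<le> real (num_admissible q r) powr (1 / real r)"
proof -
  let ?B = "B (real n / real r)"
  have root: "(?B ^ r) powr (1 / real r) = ?B"
    using B_pos[of "real n / real r"] r by (simp add: powr_powr flip: powr_realpow)
  note bounds = num_admissible_bounds[OF q(2) _ power_2_floor_alpha[OF q n]]
  have "real (num_admissible q r) \<le> real (n choose r)"
    using bounds(2) r by simp
  also have "\<dots> \<le> ?B ^ r" using binomial_entropy_bounds r by blast
  finally have "real (num_admissible q r) powr (1 / real r) \<le> (?B ^ r) powr (1 / real r)"
    by (intro powr_mono2) auto
  then show "real (num_admissible q r) powr (1 / real r) \<le> ?B" by (simp only: root)
  have "real (n choose r) \<le> real (n * num_admissible q r)"
    using bounds(1) r by (simp only: of_nat_le_iff)
  then have "?B ^ r \<le> real (Suc n) * real (n * num_admissible q r)"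
    using binomial_entropy_bounds(2)[OF r] by (rule_tac order_trans) (auto intro: mult_left_mono)
  then have "(?B ^ r) powr (1 / real r) \<le>
      ((real (Suc n) * real n) * real (num_admissible q r)) powr (1 / real r)"
    using B_pos[of "real n / real r"] r by (intro powr_mono2) (auto simp: mult_ac)
  then have "?B \<le> (real (Suc n) * real n) powr (1 / real r) *
      real (num_admissible q r) powr (1 / real r)"
    by (simp only: root powr_mult)
  moreover have "(real (Suc n) * real n) powr (1 / real r) > 0" using r by simp
  ultimately show "?B / (real (Suc n) * real n) powr (1 / real r)
           \<le> real (num_admissible q r) powr (1 / real r)"
    by (simp only: pos_divide_le_eq mult.commute)
qed

lemma num_admissible_root_limit:
  assumes q: "odd q" "q \<ge> 3"
  shows "(\<lambda>r. real (num_admissible q r) powr (1 / real r)) \<longlonglongrightarrow> B_odd q"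
proof -
  define a where "a = alpha q"
  have a: "a > 1" unfolding a_def using q by (simp add: alpha_gt_1)
  define n where "n r = nat \<lfloor>a * real r\<rfloor>" for r
  have n_le: "real (n r) \<le> a * real r" and n_ge: "a * real r - 1 \<le> real (n r)" for r
    using a by (simp_all add: n_def)
  have ratio: "(\<lambda>r. real (n r) / real r) \<longlonglongrightarrow> a"
  proof (rule tendsto_sandwich[of "\<lambda>r. a - 1 / real r" _ _ "\<lambda>_. a"])
    show "eventually (\<lambda>r. a - 1 / real r \<le> real (n r) / real r) sequentially"
      using eventually_gt_at_top[of 0]
    proof eventually_elim
      case (elim r)
      then show ?case using divide_right_mono[OF n_ge[of r], of "real r"]
        by (simp add: diff_divide_distrib)
    qed
    show "eventually (\<lambda>r. real (n r) / real r \<le> a) sequentially"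
      using eventually_gt_at_top[of 0] by eventually_elim (use n_le in \<open>simp add: pos_divide_le_eq\<close>)
    show "(\<lambda>r. a - 1 / real r) \<longlonglongrightarrow> a" by real_asymp
  qed auto
  have B_lim: "(\<lambda>r. B (real (n r) / real r)) \<longlonglongrightarrow> B_odd q"
    unfolding B_odd_def a_def[symmetric] using isCont_tendsto_compose[OF isCont_B[OF a] ratio] .
  \<comment> \<open>The quotient \<open>n r / r\<close> tends to \<open>a > 1\<close>, so it
    eventually exceeds 1.\<close>
  have large: "eventually (\<lambda>r. 0 < r \<and> r < n r) sequentially"
    using eventually_gt_at_top[of 0] order_tendstoD(1)[OF ratio a]
    by eventually_elim simp
  \<comment> \<open>An explicit majorant of the root correction, free of the floor because
    \<open>n r \<le> a * r\<close>. Dividing by it only weakens the lower bound, and its limit can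
    be evaluated directly.\<close>
  define f where "f r = ((a * real r + 1) * (a * real r)) powr (1 / real r)" for r
  have "f \<longlonglongrightarrow> 1" unfolding f_def using a by real_asymp
  then have lower_lim: "(\<lambda>r. B (real (n r) / real r) / f r) \<longlonglongrightarrow> B_odd q"
    using tendsto_divide[OF B_lim, of f 1] by simp
  show ?thesis
  proof (rule tendsto_sandwich[OF _ _ lower_lim B_lim])
    show "eventually (\<lambda>r. B (real (n r) / real r) / f r
            \<le> real (num_admissible q r) powr (1 / real r)) sequentially"
      using large
    proof eventually_elim
      case (elim r)
      have "(real (Suc (n r)) * real (n r)) powr (1 / real r) \<le> f r"
        unfolding f_def using n_le[of r] a by (intro powr_mono2 mult_mono) auto
      then have "B (real (n r) / real r) / f r
          \<le> B (real (n r) / real r) / (real (Suc (n r)) * real (n r)) powr (1 / real r)"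
        using elim B_pos[of "real (n r) / real r"]
        by (intro divide_left_mono mult_pos_pos order_less_le_trans[of 0 _ "f r"]) auto
      then show ?case
        using num_admissible_powr_bounds(2)[OF q _ elim[THEN conjunct1] elim[THEN conjunct2]]
        by (simp add: n_def a_def)
    qed
    show "eventually (\<lambda>r. real (num_admissible q r) powr (1 / real r)
            \<le> B (real (n r) / real r)) sequentially"
      using large
      by eventually_elim (use num_admissible_powr_bounds(1)[OF q] in \<open>simp add: n_def a_def\<close>)
  qed
qed

lemma num_admissible_ratio_limit:
  assumes "odd p" "p \<ge> 3" "odd q" "q \<ge> 3"
  shows "(\<lambda>r. (real (num_admissible p r) / real (num_admissible q r)) powr (1 / real r))
           \<longlonglongrightarrow> B_odd p / B_odd q"
proof -
  have "B_odd q > 0" using assms by (simp add: B_odd_def B_pos alpha_gt_1)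
  then show ?thesis
    using tendsto_divide[OF num_admissible_root_limit num_admissible_root_limit] assms
    by (simp add: powr_divide)
qed

lemma B_odd_strict_mono: "strict_mono_on {q. odd q \<and> q \<ge> 3} B_odd"
  by (rule strict_mono_onI) (auto simp: B_odd_def alpha_def less_log_iff intro!: B_strict_mono)

subsection \<open>Numerical values\<close>

text \<open>Here \<open>ln x = 2 * artanh y\<close>. The partial sums bound it from below, and the
  tail is dominated by a geometric series of ratio \<open>y\<^sup>2\<close>. Having \<open>y\<close>
  as a separate variable allows it to be supplied as a reduced fraction.\<close>

lemma ln_enclosure:
  fixes x y l u :: real
  assumes "x > 1" "y = (x - 1) / (x + 1)"
    and "l \<le> (\<Sum>k<n. 2 * y ^ (2 * k + 1) / of_nat (2 * k + 1))"
    and "(\<Sum>k<n. 2 * y ^ (2 * k + 1) / of_nat (2 * k + 1)) +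
           2 * (y ^ (2 * n + 1) / (1 - y\<^sup>2) / of_nat (2 * n + 1)) \<le> u"
  shows "l \<le> ln x \<and> ln x \<le> u"
  using ln_approx_bounds[of x n] assms(1,3,4) unfolding assms(2) atLeastAtMost_iff by linarith

text \<open>Splitting the exponents between the two sides keeps them natural numbers, so the
  identity can be checked by plain arithmetic even when \<open>x / y\<close> has a
  denominator.\<close>

lemma ln_smooth_factor:
  fixes x y :: real
  assumes "2 ^ a * 3 ^ b * 5 ^ c * 7 ^ d * x = 2 ^ a' * 3 ^ b' * 5 ^ c' * 7 ^ d' * y" "x > 0" "y > 0"
  shows "ln x = (real a' - real a) * ln 2 + (real b' - real b) * ln 3 +
           (real c' - real c) * ln 5 + (real d' - real d) * ln 7 + ln y"
proof -
  have "ln (2 ^ a * 3 ^ b * 5 ^ c * 7 ^ d * x) =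
      real a * ln 2 + real b * ln 3 + real c * ln 5 + real d * ln 7 + ln x"
    using assms(2,3) by (simp add: ln_mult ln_realpow)
  moreover have "ln (2 ^ a' * 3 ^ b' * 5 ^ c' * 7 ^ d' * y) =
      real a' * ln 2 + real b' * ln 3 + real c' * ln 5 + real d' * ln 7 + ln y"
    using assms(2,3) by (simp add: ln_mult ln_realpow)
  ultimately show ?thesis unfolding assms(1) left_diff_distrib by linarith
qed

text \<open>Only \<open>ln 2\<close> is summed directly. The others come from \<open>3 / 2\<close>,
  \<open>5 / 4\<close> and \<open>7 / 4\<close>, whose arguments \<open>y\<close> are below
  \<open>1 / 3\<close> and need fewer terms.\<close>

lemma ln_2_3_5_7:
  shows
    "69314718055994530 / 10 ^ 17 \<le> ln (2 :: real)" "ln (2 :: real) \<le> 69314718055994532 / 10 ^ 17"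
    "109861228866810968 / 10 ^ 17 \<le> ln (3 :: real)" "ln (3 :: real) \<le> 109861228866810970 / 10 ^ 17"
    "160943791243410036 / 10 ^ 17 \<le> ln (5 :: real)" "ln (5 :: real) \<le> 160943791243410038 / 10 ^ 17"
    "194591014905531330 / 10 ^ 17 \<le> ln (7 :: real)" "ln (7 :: real) \<le> 194591014905531332 / 10 ^ 17"
proof -
  have "693147180559945309 / 10 ^ 18 \<le> ln (2 :: real) \<and>
      ln (2 :: real) \<le> 693147180559945310 / 10 ^ 18"
    by (rule ln_enclosure[where n = 19 and y = "1 / 3"])
       (simp_all add: lessThan_nat_numeral power_divide)
  moreover
  have "405465108108164381 / 10 ^ 18 \<le> ln (3 / 2 :: real) \<and>
      ln (3 / 2 :: real) \<le> 405465108108164383 / 10 ^ 18"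
    by (rule ln_enclosure[where n = 14 and y = "1 / 5"])
       (simp_all add: lessThan_nat_numeral power_divide)
  moreover
  have "223143551314209755 / 10 ^ 18 \<le> ln (5 / 4 :: real) \<and>
      ln (5 / 4 :: real) \<le> 223143551314209756 / 10 ^ 18"
    by (rule ln_enclosure[where n = 10 and y = "1 / 9"])
       (simp_all add: lessThan_nat_numeral power_divide)
  moreover
  have "559615787935422686 / 10 ^ 18 \<le> ln (7 / 4 :: real) \<and>
      ln (7 / 4 :: real) \<le> 559615787935422687 / 10 ^ 18"
    by (rule ln_enclosure[where n = 16 and y = "3 / 11"])
       (simp_all add: lessThan_nat_numeral power_divide)
  moreover have "ln (3 / 2 :: real) = ln 3 - ln 2" "ln (5 / 4 :: real) = ln 5 - 2 * ln 2"
    "ln (7 / 4 :: real) = ln 7 - 2 * ln 2"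
    using ln_realpow[of 2 2] by (simp_all add: ln_div)
  ultimately show
    "69314718055994530 / 10 ^ 17 \<le> ln (2 :: real)" "ln (2 :: real) \<le> 69314718055994532 / 10 ^ 17"
    "109861228866810968 / 10 ^ 17 \<le> ln (3 :: real)" "ln (3 :: real) \<le> 109861228866810970 / 10 ^ 17"
    "160943791243410036 / 10 ^ 17 \<le> ln (5 :: real)" "ln (5 :: real) \<le> 160943791243410038 / 10 ^ 17"
    "194591014905531330 / 10 ^ 17 \<le> ln (7 :: real)" "ln (7 :: real) \<le> 194591014905531332 / 10 ^ 17"
    by simp_all
qed

section \<open>Enclosures of \<open>ln (B_odd q)\<close> for \<open>q = 3, 5, 7\<close>\<close>

lemma ln_B_odd_lower:
  assumes "q > 0" "x > 1" "x * ln 2 < ln (real q)" "l \<le> x * ln x - (x - 1) * ln (x - 1)"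
  shows "l < ln (B_odd q)"
proof -
  have "x < alpha q" using assms(1,3) by (simp add: alpha_def log_def pos_less_divide_eq)
  then have "B x < B_odd q" unfolding B_odd_def by (intro B_strict_mono assms(2))
  then have "ln (B x) < ln (B_odd q)" using B_pos[OF assms(2)] by simp
  then show ?thesis using assms(4) ln_B[OF assms(2)] by simp
qed

lemma ln_B_odd_upper:
  assumes "q > 2" "ln (real q) < x * ln 2" "x * ln x - (x - 1) * ln (x - 1) \<le> u"
  shows "ln (B_odd q) < u"
proof -
  have gt_1: "alpha q > 1" using assms(1) by (simp add: alpha_gt_1)
  have less: "alpha q < x" using assms(1,2) by (simp add: alpha_def log_def pos_divide_less_eq)
  then have "B_odd q < B x" unfolding B_odd_def by (intro B_strict_mono gt_1)
  then have "ln (B_odd q) < ln (B x)" using B_pos[OF gt_1] by (simp add: B_odd_def)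
  then show ?thesis using assms(3) ln_B[of x] less gt_1 by simp
qed

text \<open>The witness lies below \<open>alpha 3\<close> by less than \<open>4 / 10 ^ 12\<close>,
  and \<open>ln B\<close> has slope below 1 there, so hardly anything is lost. The facts
  \<open>a\<close> and \<open>b\<close> enclose the logarithms of \<open>x\<close> and
  \<open>x - 1\<close>. The other five enclosures follow the same pattern.\<close>

lemma ln_B_odd_3_lower: "10436328158535 / 10 ^ 13 < ln (B_odd 3)"
proof (rule ln_B_odd_lower[where x = "1988215 / 1254424"])
  have "63054759184353 / 10 ^ 16 \<le> ln (9941075 / 9878589 :: real) \<and>
      ln (9941075 / 9878589 :: real) \<le> 63054759184356 / 10 ^ 16"
    by (rule ln_enclosure[where n = 3 and y = "31243 / 9909832"])
       (simp_all add: lessThan_nat_numeral power_divide)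
  \<comment> \<open>The exponents encode \<open>40 * x = 63 * y\<close>, with \<open>63 / 40\<close>
    a smooth number close to \<open>x\<close>. For \<open>x - 1\<close> below, the smooth number is
    \<open>7 / 12\<close>.\<close>
  then have a: "460560748196030 / 10 ^ 15 \<le> ln (1988215 / 1254424 :: real)"
      "ln (1988215 / 1254424 :: real) \<le> 460560748196033 / 10 ^ 15"
    using ln_2_3_5_7 ln_smooth_factor[of 3 0 1 0 "1988215 / 1254424" 0 2 0 1 "9941075 / 9878589"]
    by (simp_all add: algebra_simps)
  have "27889655901538 / 10 ^ 16 \<le> ln (2201373 / 2195242 :: real) \<and>
      ln (2201373 / 2195242 :: real) \<le> 27889655901541 / 10 ^ 16"
    by (rule ln_enclosure[where n = 3 and y = "6131 / 4396615"])
       (simp_all add: lessThan_nat_numeral power_divide)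
  then have b: "-536207535142535 / 10 ^ 15 \<le> ln (733791 / 1254424 :: real)"
      "ln (733791 / 1254424 :: real) \<le> -536207535142532 / 10 ^ 15"
    using ln_2_3_5_7 ln_smooth_factor[of 2 1 0 0 "733791 / 1254424" 0 0 0 1 "2201373 / 2195242"]
    by (simp_all add: algebra_simps)
  let ?x = "1988215 / 1254424 :: real"
  show "10436328158535 / 10 ^ 13 \<le> ?x * ln ?x - (?x - 1) * ln (?x - 1)"
    using a b by simp
qed (use ln_2_3_5_7 in simp_all)

lemma ln_B_odd_3_upper: "ln (B_odd 3) < 10436328158579 / 10 ^ 13"
proof (rule ln_B_odd_upper[where x = "301994 / 190537"])
  have "63054759210750 / 10 ^ 16 \<le> ln (1725680 / 1714833 :: real) \<and>
      ln (1725680 / 1714833 :: real) \<le> 63054759210753 / 10 ^ 16"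
    by (rule ln_enclosure[where n = 3 and y = "10847 / 3440513"])
       (simp_all add: lessThan_nat_numeral power_divide)
  then have a: "460560748198670 / 10 ^ 15 \<le> ln (301994 / 190537 :: real)"
      "ln (301994 / 190537 :: real) \<le> 460560748198673 / 10 ^ 15"
    using ln_2_3_5_7 ln_smooth_factor[of 3 0 1 0 "301994 / 190537" 0 2 0 1 "1725680 / 1714833"]
    by (simp_all add: algebra_simps)
  have "27889655973062 / 10 ^ 16 \<le> ln (1337484 / 1333759 :: real) \<and>
      ln (1337484 / 1333759 :: real) \<le> 27889655973065 / 10 ^ 16"
    by (rule ln_enclosure[where n = 3 and y = "3725 / 2671243"])
       (simp_all add: lessThan_nat_numeral power_divide)
  then have b: "-536207535135382 / 10 ^ 15 \<le> ln (111457 / 190537 :: real)"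
      "ln (111457 / 190537 :: real) \<le> -536207535135379 / 10 ^ 15"
    using ln_2_3_5_7 ln_smooth_factor[of 2 1 0 0 "111457 / 190537" 0 0 0 1 "1337484 / 1333759"]
    by (simp_all add: algebra_simps)
  let ?x = "301994 / 190537 :: real"
  show "?x * ln ?x - (?x - 1) * ln (?x - 1) \<le> 10436328158579 / 10 ^ 13"
    using a b by simp
qed (use ln_2_3_5_7 in simp_all)

lemma ln_B_odd_5_lower: "15870486930143 / 10 ^ 13 < ln (B_odd 5)"
proof (rule ln_B_odd_lower[where x = "2677745 / 1153242"])
  \<comment> \<open>The smooth numbers for \<open>q = 5\<close> are \<open>16 / 7\<close> for
    \<open>x\<close> and \<open>21 / 16\<close> for \<open>x - 1\<close>. The first leaves a
    cofactor about 1.6 percent above 1, hence a fourth term of the series.\<close>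
  have "157193427227789 / 10 ^ 16 \<le> ln (18744215 / 18451872 :: real) \<and>
      ln (18744215 / 18451872 :: real) \<le> 157193427227792 / 10 ^ 16"
    by (rule ln_enclosure[where n = 4 and y = "292343 / 37196087"])
       (simp_all add: lessThan_nat_numeral power_divide)
  then have a: "842397915907245 / 10 ^ 15 \<le> ln (2677745 / 1153242 :: real)"
      "ln (2677745 / 1153242 :: real) \<le> 842397915907248 / 10 ^ 15"
    using ln_2_3_5_7 ln_smooth_factor[of 0 0 0 1 "2677745 / 1153242" 4 0 0 0 "18744215 / 18451872"]
    by (simp_all add: algebra_simps)
  have "71576333045835 / 10 ^ 16 \<le> ln (12196024 / 12109041 :: real) \<and>
      ln (12196024 / 12109041 :: real) \<le> 71576333045838 / 10 ^ 16"
    by (rule ln_enclosure[where n = 3 and y = "86983 / 24305065"])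
       (simp_all add: lessThan_nat_numeral power_divide)
  then have b: "279091348788224 / 10 ^ 15 \<le> ln (1524503 / 1153242 :: real)"
      "ln (1524503 / 1153242 :: real) \<le> 279091348788227 / 10 ^ 15"
    using ln_2_3_5_7 ln_smooth_factor[of 4 0 0 0 "1524503 / 1153242" 0 1 0 1 "12196024 / 12109041"]
    by (simp_all add: algebra_simps)
  let ?x = "2677745 / 1153242 :: real"
  show "15870486930143 / 10 ^ 13 \<le> ?x * ln ?x - (?x - 1) * ln (?x - 1)"
    using a b by simp
qed (use ln_2_3_5_7 in simp_all)

lemma ln_B_odd_5_upper: "ln (B_odd 5) < 15870486930166 / 10 ^ 13"
proof (rule ln_B_odd_upper[where x = "4495889 / 1936274"])
  have "157193427243218 / 10 ^ 16 \<le> ln (31471223 / 30980384 :: real) \<and>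
      ln (31471223 / 30980384 :: real) \<le> 157193427243221 / 10 ^ 16"
    by (rule ln_enclosure[where n = 4 and y = "490839 / 62451607"])
       (simp_all add: lessThan_nat_numeral power_divide)
  then have a: "842397915908788 / 10 ^ 15 \<le> ln (4495889 / 1936274 :: real)"
      "ln (4495889 / 1936274 :: real) \<le> 842397915908791 / 10 ^ 15"
    using ln_2_3_5_7 ln_smooth_factor[of 0 0 0 1 "4495889 / 1936274" 4 0 0 0 "31471223 / 30980384"]
    by (simp_all add: algebra_simps)
  have "71576333072936 / 10 ^ 16 \<le> ln (6825640 / 6776959 :: real) \<and>
      ln (6825640 / 6776959 :: real) \<le> 71576333072939 / 10 ^ 16"
    by (rule ln_enclosure[where n = 3 and y = "48681 / 13602599"])
       (simp_all add: lessThan_nat_numeral power_divide)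
  then have b: "279091348790934 / 10 ^ 15 \<le> ln (2559615 / 1936274 :: real)"
      "ln (2559615 / 1936274 :: real) \<le> 279091348790937 / 10 ^ 15"
    using ln_2_3_5_7 ln_smooth_factor[of 4 0 0 0 "2559615 / 1936274" 0 1 0 1 "6825640 / 6776959"]
    by (simp_all add: algebra_simps)
  let ?x = "4495889 / 1936274 :: real"
  show "?x * ln ?x - (?x - 1) * ln (?x - 1) \<le> 15870486930166 / 10 ^ 13"
    using a b by simp
qed (use ln_2_3_5_7 in simp_all)

lemma ln_B_odd_7_lower: "18281626621608 / 10 ^ 13 < ln (B_odd 7)"
proof (rule ln_B_odd_lower[where x = "1273419 / 453601"])
  have "26233139785850 / 10 ^ 16 \<le> ln (909585 / 907202 :: real) \<and>
      ln (909585 / 907202 :: real) \<le> 26233139785853 / 10 ^ 16"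
    by (rule ln_enclosure[where n = 3 and y = "2383 / 1816787"])
       (simp_all add: lessThan_nat_numeral power_divide)
  \<comment> \<open>The smooth numbers for \<open>q = 7\<close> are \<open>14 / 5\<close> for
    \<open>x\<close> and \<open>9 / 5\<close> for \<open>x - 1\<close>.\<close>
  then have a: "1032242731159742 / 10 ^ 15 \<le> ln (1273419 / 453601 :: real)"
      "ln (1273419 / 453601 :: real) \<le> 1032242731159745 / 10 ^ 15"
    using ln_2_3_5_7 ln_smooth_factor[of 0 0 1 0 "1273419 / 453601" 1 0 0 1 "909585 / 907202"]
    by (simp_all add: algebra_simps)
  have "40777425052002 / 10 ^ 16 \<le> ln (4099090 / 4082409 :: real) \<and>
      ln (4099090 / 4082409 :: real) \<le> 40777425052005 / 10 ^ 16"
    by (rule ln_enclosure[where n = 3 and y = "16681 / 8181499"])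
       (simp_all add: lessThan_nat_numeral power_divide)
  then have b: "591864407407318 / 10 ^ 15 \<le> ln (819818 / 453601 :: real)"
      "ln (819818 / 453601 :: real) \<le> 591864407407321 / 10 ^ 15"
    using ln_2_3_5_7 ln_smooth_factor[of 0 0 1 0 "819818 / 453601" 0 2 0 0 "4099090 / 4082409"]
    by (simp_all add: algebra_simps)
  let ?x = "1273419 / 453601 :: real"
  show "18281626621608 / 10 ^ 13 \<le> ?x * ln ?x - (?x - 1) * ln (?x - 1)"
    using a b by simp
qed (use ln_2_3_5_7 in simp_all)

lemma ln_B_odd_7_upper: "ln (B_odd 7) < 18281626621628 / 10 ^ 13"
proof (rule ln_B_odd_upper[where x = "1529767 / 544914"])
  have "26233139800261 / 10 ^ 16 \<le> ln (7648835 / 7628796 :: real) \<and>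
      ln (7648835 / 7628796 :: real) \<le> 26233139800264 / 10 ^ 16"
    by (rule ln_enclosure[where n = 3 and y = "20039 / 15277631"])
       (simp_all add: lessThan_nat_numeral power_divide)
  then have a: "1032242731161183 / 10 ^ 15 \<le> ln (1529767 / 544914 :: real)"
      "ln (1529767 / 544914 :: real) \<le> 1032242731161186 / 10 ^ 15"
    using ln_2_3_5_7 ln_smooth_factor[of 0 0 1 0 "1529767 / 544914" 1 0 0 1 "7648835 / 7628796"]
    by (simp_all add: algebra_simps)
  have "40777425074387 / 10 ^ 16 \<le> ln (4924265 / 4904226 :: real) \<and>
      ln (4924265 / 4904226 :: real) \<le> 40777425074390 / 10 ^ 16"
    by (rule ln_enclosure[where n = 3 and y = "20039 / 9828491"])
       (simp_all add: lessThan_nat_numeral power_divide)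
  then have b: "591864407409556 / 10 ^ 15 \<le> ln (984853 / 544914 :: real)"
      "ln (984853 / 544914 :: real) \<le> 591864407409559 / 10 ^ 15"
    using ln_2_3_5_7 ln_smooth_factor[of 0 0 1 0 "984853 / 544914" 0 2 0 0 "4924265 / 4904226"]
    by (simp_all add: algebra_simps)
  let ?x = "1529767 / 544914 :: real"
  show "?x * ln ?x - (?x - 1) * ln (?x - 1) \<le> 18281626621628 / 10 ^ 13"
    using a b by simp
qed (use ln_2_3_5_7 in simp_all)

section \<open>The two quotients to ten decimals\<close>

lemma B_odd_5_3_approx: "\<bar>B_odd 5 / B_odd 3 - 1.7218785536\<bar> < 5 / 10 ^ 11"
proof -
  \<comment> \<open>The quotient is trapped between two fractions that lie within the tolerance
    around the decimal value. They are small enough for their logarithms to be enclosed, with smooth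
    number \<open>12 / 7\<close>.\<close>
  have "44193763973897 / 10 ^ 16 \<le> ln (176659 / 175880 :: real) \<and>
      ln (176659 / 175880 :: real) \<le> 44193763973900 / 10 ^ 16"
    by (rule ln_enclosure[where n = 3 and y = "779 / 352539"])
       (simp_all add: lessThan_nat_numeral power_divide)
  then have l: "543415877130075 / 10 ^ 15 \<le> ln (75711 / 43970 :: real)"
      "ln (75711 / 43970 :: real) \<le> 543415877130078 / 10 ^ 15"
    using ln_2_3_5_7 ln_smooth_factor[of 0 0 0 1 "75711 / 43970" 2 1 0 0 "176659 / 175880"]
    by (simp_all add: algebra_simps)
  have "44193764490043 / 10 ^ 16 \<le> ln (440627 / 438684 :: real) \<and>
      ln (440627 / 438684 :: real) \<le> 44193764490046 / 10 ^ 16"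
    by (rule ln_enclosure[where n = 3 and y = "1943 / 879311"])
       (simp_all add: lessThan_nat_numeral power_divide)
  then have u: "543415877181690 / 10 ^ 15 \<le> ln (440627 / 255899 :: real)"
      "ln (440627 / 255899 :: real) \<le> 543415877181693 / 10 ^ 15"
    using ln_2_3_5_7 ln_smooth_factor[of 0 0 0 1 "440627 / 255899" 2 1 0 0 "440627 / 438684"]
    by (simp_all add: algebra_simps)
  have pos: "B_odd 5 > 0" "B_odd 3 > 0" by (simp_all add: B_odd_def B_pos alpha_gt_1)
  then have "ln (B_odd 5 / B_odd 3) = ln (B_odd 5) - ln (B_odd 3)" by (simp add: ln_div)
  \<comment> \<open>Each side pairs a lower bound for one \<open>B_odd\<close> with an upper bound
    for the other.\<close>
  then have "ln (75711 / 43970) < ln (B_odd 5 / B_odd 3)"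
    and "ln (B_odd 5 / B_odd 3) < ln (440627 / 255899)"
    using l u ln_B_odd_5_lower ln_B_odd_5_upper ln_B_odd_3_lower ln_B_odd_3_upper by simp_all
  then have "75711 / 43970 < B_odd 5 / B_odd 3"
    and "B_odd 5 / B_odd 3 < 440627 / 255899"
    using pos by (subst (asm) (1 2) ln_less_cancel_iff; simp)+
  moreover have "1.7218785536 - 5 / 10 ^ 11 < (75711 / 43970 :: real)"
      "440627 / 255899 < (1.7218785536 + 5 / 10 ^ 11 :: real)" by simp_all
  ultimately show ?thesis unfolding abs_diff_less_iff by (meson order.strict_trans)
qed

lemma B_odd_7_5_approx: "\<bar>B_odd 7 / B_odd 5 - 1.2726660717\<bar> < 5 / 10 ^ 11"
proof -
  \<comment> \<open>Again two fractions within the tolerance, now with smooth number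
    \<open>80 / 63\<close>.\<close>
  have "22220608225431 / 10 ^ 16 \<le> ln (7860447 / 7843000 :: real) \<and>
      ln (7860447 / 7843000 :: real) \<le> 22220608225434 / 10 ^ 16"
    by (rule ln_enclosure[where n = 3 and y = "17447 / 15703447"])
       (simp_all add: lessThan_nat_numeral power_divide)
  then have l: "241113969104891 / 10 ^ 15 \<le> ln (249538 / 196075 :: real)"
      "ln (249538 / 196075 :: real) \<le> 241113969104894 / 10 ^ 15"
    using ln_2_3_5_7 ln_smooth_factor[of 0 2 0 1 "249538 / 196075" 4 0 1 0 "7860447 / 7843000"]
    by (simp_all add: algebra_simps)
  have "22220608960248 / 10 ^ 16 \<le> ln (91824453 / 91620640 :: real) \<and>
      ln (91824453 / 91620640 :: real) \<le> 22220608960251 / 10 ^ 16"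
    by (rule ln_enclosure[where n = 3 and y = "203813 / 183445093"])
       (simp_all add: lessThan_nat_numeral power_divide)
  then have u: "241113969178372 / 10 ^ 15 \<le> ln (1457531 / 1145258 :: real)"
      "ln (1457531 / 1145258 :: real) \<le> 241113969178375 / 10 ^ 15"
    using ln_2_3_5_7 ln_smooth_factor[of 0 2 0 1 "1457531 / 1145258" 4 0 1 0 "91824453 / 91620640"]
    by (simp_all add: algebra_simps)
  have pos: "B_odd 7 > 0" "B_odd 5 > 0" by (simp_all add: B_odd_def B_pos alpha_gt_1)
  then have "ln (B_odd 7 / B_odd 5) = ln (B_odd 7) - ln (B_odd 5)" by (simp add: ln_div)
  then have "ln (249538 / 196075) < ln (B_odd 7 / B_odd 5)"
    and "ln (B_odd 7 / B_odd 5) < ln (1457531 / 1145258)"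
    using l u ln_B_odd_7_lower ln_B_odd_7_upper ln_B_odd_5_lower ln_B_odd_5_upper by simp_all
  then have "249538 / 196075 < B_odd 7 / B_odd 5"
    and "B_odd 7 / B_odd 5 < 1457531 / 1145258"
    using pos by (subst (asm) (1 2) ln_less_cancel_iff; simp)+
  moreover have "1.2726660717 - 5 / 10 ^ 11 < (249538 / 196075 :: real)"
      "1457531 / 1145258 < (1.2726660717 + 5 / 10 ^ 11 :: real)" by simp_all
  ultimately show ?thesis unfolding abs_diff_less_iff by (meson order.strict_trans)
qed

text \<open>Agreement with the displayed decimals is expressed as an error below half a unit in the
  tenth decimal place.\<close>

theorem corollary11:
  shows "(\<forall>q::nat. odd q \<and> q \<ge> 3 \<longrightarrow>
            (\<lambda>r. real (num_admissible q r) powr (1 / real r)) \<longlonglongrightarrow> B_odd q)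
       \<and> strict_mono_on {q::nat. odd q \<and> q \<ge> 3} B_odd
       \<and> (\<lambda>r. (real (num_admissible 5 r) / real (num_admissible 3 r)) powr (1 / real r))
            \<longlonglongrightarrow> B_odd 5 / B_odd 3
       \<and> \<bar>B_odd 5 / B_odd 3 - 1.7218785536\<bar> < 5 / 10 ^ 11
       \<and> (\<lambda>r. (real (num_admissible 7 r) / real (num_admissible 5 r)) powr (1 / real r))
            \<longlonglongrightarrow> B_odd 7 / B_odd 5
       \<and> \<bar>B_odd 7 / B_odd 5 - 1.2726660717\<bar> < 5 / 10 ^ 11"
proof (intro conjI allI impI)
  show "(\<lambda>r. real (num_admissible q r) powr (1 / real r)) \<longlonglongrightarrow> B_odd q" if "odd q \<and> q \<ge> 3" for q
    using that num_admissible_root_limit by blast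
qed (use B_odd_strict_mono num_admissible_ratio_limit B_odd_5_3_approx B_odd_7_5_approx in simp_all)

end
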